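(* Let $A$ be a finite dimensional semisimple associative algebra over $\mathbb{C}$ and let $V$ be a vertex algebra. Let $M$ be an $A\otimes V$-module. Assume that for any finite dimensional $A$-submodule $X$ of $M$ and any $f\in\mathrm{Hom}_A(X,M)$ there exist $v^1,\dots,v^n\in V$ and $i_1,\dots,i_n\in\mathbb{Z}$ such that $f=v^1_{i_1}+\cdots+v^n_{i_n}$ (as maps $X\to M$). Then: (1) $M_\lambda$ is an irreducible $V$-module for any $\lambda\in\mathrm{Irr}_M(A)$. (2) For $\lambda,\mu\in\mathrm{Irr}_M(A)$, $M_\lambda\cong M_\mu$ as $V$-modules if and only if $\lambda=\mu$.
   Context: All vector spaces are over $\mathbb{C}$; $\delta(z)=\sum_{n\in\mathbb{Z}}z^n$ and binomials are expanded in nonnegative powers of the second variable. A vertex algebra is a vector space $V$ with a vector $\mathbf{1}\in V$ and a linear map $v\mapsto Y(v,z)=\sum_{n\in\mathbb{Z}}v_nz^{-n-1}\in(\mathrm{End}\,V)[[z,z^{-1}]]$ such that $u_nv=0$ for $n$ large, $Y(\mathbf{1},z)=\mathrm{Id}_V$, $Y(v,z)\mathbf{1}\in V[[z]]$ with constant term $v$, and the Jacobi identity holds: $$z_0^{-1}\delta\left(\tfrac{z_1-z_2}{z_0}\right)Y(u,z_1)Y(v,z_2)-z_0^{-1}\delta\left(\tfrac{z_2-z_1}{-z_0}\right)Y(v,z_2)Y(u,z_1)=z_2^{-1}\delta\left(\tfrac{z_1-z_0}{z_2}\right)Y(Y(u,z_0)v,z_2).$$ A $V$-module is a vector space $M$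 with a linear map $v\mapsto Y_M(v,z)=\sum_{n\in\mathbb{Z}}v_nz^{-n-1}\in(\mathrm{End}\,M)[[z,z^{-1}]]$ with $v_nw=0$ for $n$ large ($w\in M$), $Y_M(\mathbf{1},z)=\mathrm{Id}_M$ and the Jacobi identity above with the outer $Y$'s replaced by $Y_M$. Submodules are subspaces stable under all $v_n$; isomorphisms are linear bijections commuting with all $v_n$; irreducible means nonzero with no proper nonzero submodule. An $A\otimes V$-module is a vector space $M$ that is both an $A$-module and a $V$-module such that the two actions commute. For an irreducible character $\lambda$ of $A$, $W_\lambda$ denotes the corresponding simple $A$-module and $M_\lambda=\mathrm{Hom}_A(W_\lambda,M)$ the multiplicity space, a $V$-module via $(v_nf)(w)=v_n(f(w))$. $\mathrm{Irr}_M(A)$ is the set of those (isomorphism classes of) irreducible $A$-modules, labelled by their characters $\lambda$, with $\mathrm{Hom}_A(W_\lambda,M)\neq0$. *)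

theory Defs
  imports Complex_Main "HOL-Library.Function_Algebras" "HOL-Library.Groups_Big_Fun"
begin

context vector_space
begin

definition finite_dim :: "'b set \<Rightarrow> bool" where
  "finite_dim X \<longleftrightarrow> (\<exists>B. finite B \<and> span B = X)"

text \<open>The trace of an endomorphism of a finite dimensional space, computed in the basis
  \<open>extend_basis {}\<close>, which is an arbitrary basis of the whole space.\<close>

definition endo_trace :: "('b \<Rightarrow> 'b) \<Rightarrow> 'a" where
  "endo_trace f = (let B = extend_basis {} in \<Sum>b\<in>B. representation B (f b) b)"

end

text \<open>Algebras are associative and unital. The classes \<open>ring\<close> and \<open>monoid_mult\<close> are used
  in place of \<open>ring_1\<close> so that the zero algebra is not excluded.\<close>

locale assoc_algebra = vector_space sA
  for sA :: "complex \<Rightarrow> 'a::{ring,monoid_mult} \<Rightarrow> 'a" +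
  assumes scale_mult_left: "sA c x * y = sA c (x * y)"
    and scale_mult_right: "x * sA c y = sA c (x * y)"

locale alg_module = assoc_algebra sA + M: vector_space sM
  for sA :: "complex \<Rightarrow> 'a::{ring,monoid_mult} \<Rightarrow> 'a"
    and sM :: "complex \<Rightarrow> 'm::ab_group_add \<Rightarrow> 'm" +
  fixes aM :: "'a \<Rightarrow> 'm \<Rightarrow> 'm"
  assumes act_add_left: "aM (x + y) w = aM x w + aM y w"
    and act_scale_left: "aM (sA c x) w = sM c (aM x w)"
    and act_add_right: "aM x (w + w') = aM x w + aM x w'"
    and act_scale_right: "aM x (sM c w) = sM c (aM x w)"
    and act_mult: "aM (x * y) w = aM x (aM y w)"
    and act_one: "aM 1 w = w"

definition alg_submodule ::
  "(complex \<Rightarrow> 'm::ab_group_add \<Rightarrow> 'm) \<Rightarrow> ('a \<Rightarrow> 'm \<Rightarrow> 'm) \<Rightarrow> 'm set \<Rightarrow> bool" where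
  "alg_submodule sM aM X \<longleftrightarrow> module.subspace sM X \<and> (\<forall>a. \<forall>x\<in>X. aM a x \<in> X)"

definition simple_submodule ::
  "(complex \<Rightarrow> 'm::ab_group_add \<Rightarrow> 'm) \<Rightarrow> ('a \<Rightarrow> 'm \<Rightarrow> 'm) \<Rightarrow> 'm set \<Rightarrow> bool" where
  "simple_submodule sM aM X \<longleftrightarrow> alg_submodule sM aM X \<and> X \<noteq> {0} \<and>
     (\<forall>U. alg_submodule sM aM U \<and> U \<subseteq> X \<longrightarrow> U = {0} \<or> U = X)"

text \<open>An algebra is semisimple if its left regular module is a sum of simple submodules, i.e. of
  minimal left ideals.\<close>

locale fd_semisimple_algebra = assoc_algebra +
  assumes finite_dimensional: "finite_dim UNIV"
    and semisimple: "span (\<Union>{L. simple_submodule sA (*) L}) = UNIV"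

text \<open>\<open>alg_hom_on sX aX X sM aM f\<close>: the restriction of \<open>f\<close> to the submodule \<open>X\<close> is a module
  homomorphism; the values of \<open>f\<close> outside \<open>X\<close> are irrelevant.\<close>

definition alg_hom_on ::
  "(complex \<Rightarrow> 'w::ab_group_add \<Rightarrow> 'w) \<Rightarrow> ('a \<Rightarrow> 'w \<Rightarrow> 'w) \<Rightarrow> 'w set \<Rightarrow>
   (complex \<Rightarrow> 'm::ab_group_add \<Rightarrow> 'm) \<Rightarrow> ('a \<Rightarrow> 'm \<Rightarrow> 'm) \<Rightarrow> ('w \<Rightarrow> 'm) \<Rightarrow> bool" where
  "alg_hom_on sX aX X sM aM f \<longleftrightarrow>
     (\<forall>x\<in>X. \<forall>y\<in>X. f (x + y) = f x + f y) \<and>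
     (\<forall>c. \<forall>x\<in>X. f (sX c x) = sM c (f x)) \<and>
     (\<forall>a. \<forall>x\<in>X. f (aX a x) = aM a (f x))"

definition character ::
  "(complex \<Rightarrow> 'w::ab_group_add \<Rightarrow> 'w) \<Rightarrow> ('a \<Rightarrow> 'w \<Rightarrow> 'w) \<Rightarrow> 'a \<Rightarrow> complex" where
  "character sW aW a = vector_space.endo_trace sW (aW a)"

text \<open>\<open>W\<close> (the type \<open>'w\<close> with scaling \<open>sW\<close> and action \<open>aW\<close>) is a simple module with character
  \<open>\<chi>\<close>, that is, a model of \<open>W\<^sub>\<chi>\<close>.\<close>

definition simple_module_with_character ::
  "(complex \<Rightarrow> 'a::{ring,monoid_mult} \<Rightarrow> 'a) \<Rightarrow> ('a \<Rightarrow> complex) \<Rightarrow>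
   (complex \<Rightarrow> 'w::ab_group_add \<Rightarrow> 'w) \<Rightarrow> ('a \<Rightarrow> 'w \<Rightarrow> 'w) \<Rightarrow> bool" where
  "simple_module_with_character sA \<chi> sW aW \<longleftrightarrow>
     alg_module sA sW aW \<and> simple_submodule sW aW UNIV \<and> character sW aW = \<chi>"

text \<open>\<open>F a b c\<close> is the coefficient of \<open>z\<^sub>0\<^sup>a z\<^sub>1\<^sup>b z\<^sub>2\<^sup>c\<close> of a formal distribution \<open>F\<close> in
  the variables \<open>z\<^sub>0, z\<^sub>1, z\<^sub>2\<close>.\<close>

type_synonym 'x fdist = "int \<Rightarrow> int \<Rightarrow> int \<Rightarrow> 'x"

text \<open>The product of a scalar distribution and a vector valued one. Each coefficient is a sum over
  all of \<open>\<int>\<^sup>3\<close>, which is meaningful only if almost all summands vanish; in the three products below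
  this is a consequence of truncation.\<close>

definition fdist_mult ::
  "(complex \<Rightarrow> 'm::ab_group_add \<Rightarrow> 'm) \<Rightarrow> complex fdist \<Rightarrow> 'm fdist \<Rightarrow> 'm fdist" where
  "fdist_mult sM D F a b c =
     Sum_any (\<lambda>(i, j, k). sM (D i j k) (F (a - i) (b - j) (c - k)))"

text \<open>The coefficient of \<open>x\<^sup>i y\<^sup>j\<close> in \<open>(x - y)\<^sup>n\<close>, expanded in nonnegative powers of \<open>y\<close>.\<close>

definition binom_coeff :: "int \<Rightarrow> int \<Rightarrow> int \<Rightarrow> complex" where
  "binom_coeff n i j =
     (if 0 \<le> j \<and> i + j = n then (-1) ^ nat j * (of_int n gchoose nat j) else 0)"

text \<open>\<open>z\<^sub>0\<^sup>-\<^sup>1 \<delta>((z\<^sub>1 - z\<^sub>2) / z\<^sub>0)\<close> is the sum over \<open>n\<close> of \<open>z\<^sub>0\<^sup>-\<^sup>n\<^sup>-\<^sup>1 (z\<^sub>1 - z\<^sub>2)\<^sup>n\<close>, so the coefficient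
  of \<open>z\<^sub>0\<^sup>a\<close> comes from \<open>n = - a - 1\<close>.\<close>

definition delta_12 :: "complex fdist" where
  "delta_12 a b c = binom_coeff (- a - 1) b c"

text \<open>\<open>z\<^sub>0\<^sup>-\<^sup>1 \<delta>((z\<^sub>2 - z\<^sub>1) / (- z\<^sub>0))\<close>, the sum over \<open>n\<close> of \<open>(-1)\<^sup>n z\<^sub>0\<^sup>-\<^sup>n\<^sup>-\<^sup>1 (z\<^sub>2 - z\<^sub>1)\<^sup>n\<close>\<close>

definition delta_21 :: "complex fdist" where
  "delta_21 a b c = (-1) powi (- a - 1) * binom_coeff (- a - 1) c b"

text \<open>\<open>z\<^sub>2\<^sup>-\<^sup>1 \<delta>((z\<^sub>1 - z\<^sub>0) / z\<^sub>2)\<close>, the sum over \<open>n\<close> of \<open>z\<^sub>2\<^sup>-\<^sup>n\<^sup>-\<^sup>1 (z\<^sub>1 - z\<^sub>0)\<^sup>n\<close>\<close>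

definition delta_10 :: "complex fdist" where
  "delta_10 a b c = binom_coeff (- c - 1) b a"

text \<open>Vertex operators are given by their modes: \<open>Y v n\<close> is \<open>v\<^sub>n\<close>, the coefficient of
  \<open>z\<^sup>-\<^sup>n\<^sup>-\<^sup>1\<close>, so the coefficient of \<open>z\<^sup>b\<close> is \<open>v\<^sub>-\<^sub>b\<^sub>-\<^sub>1\<close>. The identity is evaluated at a vector \<open>w\<close>;
  the three distributions multiplied by delta functions are, in order, \<open>Y\<^sub>M(u,z\<^sub>1) Y\<^sub>M(v,z\<^sub>2) w\<close>,
  \<open>Y\<^sub>M(v,z\<^sub>2) Y\<^sub>M(u,z\<^sub>1) w\<close> and \<open>Y\<^sub>M(Y(u,z\<^sub>0)v,z\<^sub>2) w\<close>.\<close>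

definition jacobi_identity ::
  "('v \<Rightarrow> int \<Rightarrow> 'v \<Rightarrow> 'v) \<Rightarrow> (complex \<Rightarrow> 'm::ab_group_add \<Rightarrow> 'm) \<Rightarrow> ('v \<Rightarrow> int \<Rightarrow> 'm \<Rightarrow> 'm) \<Rightarrow>
   'v \<Rightarrow> 'v \<Rightarrow> 'm \<Rightarrow> bool" where
  "jacobi_identity Y sM YM u v w \<longleftrightarrow> (\<forall>a b c.
     fdist_mult sM delta_12
       (\<lambda>a b c. if a = 0 then YM u (- b - 1) (YM v (- c - 1) w) else 0) a b c
     - fdist_mult sM delta_21
       (\<lambda>a b c. if a = 0 then YM v (- c - 1) (YM u (- b - 1) w) else 0) a b c
     = fdist_mult sM delta_10
       (\<lambda>a b c. if b = 0 then YM (Y u (- a - 1) v) (- c - 1) w else 0) a b c)"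

locale vertex_algebra = vector_space sV
  for sV :: "complex \<Rightarrow> 'v::ab_group_add \<Rightarrow> 'v" +
  fixes vac :: 'v
    and Y :: "'v \<Rightarrow> int \<Rightarrow> 'v \<Rightarrow> 'v"
  assumes Y_add_left: "Y (u + u') n v = Y u n v + Y u' n v"
    and Y_scale_left: "Y (sV c u) n v = sV c (Y u n v)"
    and Y_add_right: "Y u n (v + v') = Y u n v + Y u n v'"
    and Y_scale_right: "Y u n (sV c v) = sV c (Y u n v)"
    and Y_truncation: "\<exists>N. \<forall>n\<ge>N. Y u n v = 0"
    and Y_vac: "Y vac n v = (if n = -1 then v else 0)"
    and Y_creation: "n \<ge> 0 \<Longrightarrow> Y v n vac = 0" "Y v (-1) vac = v"
    and Y_jacobi: "jacobi_identity Y sV Y u v w"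

text \<open>The carrier of a module is a subspace \<open>S\<close> of an ambient vector space (a type), because
  multiplicity spaces are subspaces of function spaces.\<close>

locale va_module = vertex_algebra sV vac Y + M: vector_space sM
  for sV :: "complex \<Rightarrow> 'v::ab_group_add \<Rightarrow> 'v" and vac Y
    and sM :: "complex \<Rightarrow> 'm::ab_group_add \<Rightarrow> 'm" +
  fixes S :: "'m set"
    and YM :: "'v \<Rightarrow> int \<Rightarrow> 'm \<Rightarrow> 'm"
  assumes carrier_subspace: "M.subspace S"
    and YM_closed: "w \<in> S \<Longrightarrow> YM v n w \<in> S"
    and YM_add_left: "w \<in> S \<Longrightarrow> YM (v + v') n w = YM v n w + YM v' n w"
    and YM_scale_left: "w \<in> S \<Longrightarrow> YM (sV c v) n w = sM c (YM v n w)"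
    and YM_add_right: "w \<in> S \<Longrightarrow> w' \<in> S \<Longrightarrow> YM v n (w + w') = YM v n w + YM v n w'"
    and YM_scale_right: "w \<in> S \<Longrightarrow> YM v n (sM c w) = sM c (YM v n w)"
    and YM_truncation: "w \<in> S \<Longrightarrow> \<exists>N. \<forall>n\<ge>N. YM v n w = 0"
    and YM_vac: "w \<in> S \<Longrightarrow> YM vac n w = (if n = -1 then w else 0)"
    and YM_jacobi: "w \<in> S \<Longrightarrow> jacobi_identity Y sM YM u v w"

locale irreducible_va_module = va_module +
  assumes nonzero: "S \<noteq> {0}"
    and no_proper_submodule:
      "\<lbrakk>T \<subseteq> S; M.subspace T; \<And>v n w. w \<in> T \<Longrightarrow> YM v n w \<in> T\<rbrakk> \<Longrightarrow> T = {0} \<or> T = S"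

definition va_module_iso ::
  "(complex \<Rightarrow> 'm::ab_group_add \<Rightarrow> 'm) \<Rightarrow> 'm set \<Rightarrow> ('v \<Rightarrow> int \<Rightarrow> 'm \<Rightarrow> 'm) \<Rightarrow>
   (complex \<Rightarrow> 'n::ab_group_add \<Rightarrow> 'n) \<Rightarrow> 'n set \<Rightarrow> ('v \<Rightarrow> int \<Rightarrow> 'n \<Rightarrow> 'n) \<Rightarrow> ('m \<Rightarrow> 'n) \<Rightarrow> bool"
where
  "va_module_iso sM S YM sN T YN \<phi> \<longleftrightarrow> bij_betw \<phi> S T \<and>
     (\<forall>w\<in>S. \<forall>w'\<in>S. \<phi> (w + w') = \<phi> w + \<phi> w') \<and>
     (\<forall>c. \<forall>w\<in>S. \<phi> (sM c w) = sN c (\<phi> w)) \<and>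
     (\<forall>v n. \<forall>w\<in>S. \<phi> (YM v n w) = YN v n (\<phi> w))"

definition va_isomorphic ::
  "(complex \<Rightarrow> 'm::ab_group_add \<Rightarrow> 'm) \<Rightarrow> 'm set \<Rightarrow> ('v \<Rightarrow> int \<Rightarrow> 'm \<Rightarrow> 'm) \<Rightarrow>
   (complex \<Rightarrow> 'n::ab_group_add \<Rightarrow> 'n) \<Rightarrow> 'n set \<Rightarrow> ('v \<Rightarrow> int \<Rightarrow> 'n \<Rightarrow> 'n) \<Rightarrow> bool"
where
  "va_isomorphic sM S YM sN T YN \<longleftrightarrow> (\<exists>\<phi>. va_module_iso sM S YM sN T YN \<phi>)"

locale alg_va_module =
  alg_module sA sM aM + va: va_module sV vac Y sM UNIV YM
  for sA :: "complex \<Rightarrow> 'a::{ring,monoid_mult} \<Rightarrow> 'a"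
    and sV :: "complex \<Rightarrow> 'v::ab_group_add \<Rightarrow> 'v" and vac Y
    and sM :: "complex \<Rightarrow> 'm::ab_group_add \<Rightarrow> 'm" and aM YM +
  assumes actions_commute: "aM a (YM v n w) = YM v n (aM a w)"

definition mult_space ::
  "(complex \<Rightarrow> 'w::ab_group_add \<Rightarrow> 'w) \<Rightarrow> ('a \<Rightarrow> 'w \<Rightarrow> 'w) \<Rightarrow>
   (complex \<Rightarrow> 'm::ab_group_add \<Rightarrow> 'm) \<Rightarrow> ('a \<Rightarrow> 'm \<Rightarrow> 'm) \<Rightarrow> ('w \<Rightarrow> 'm) set" where
  "mult_space sW aW sM aM = {f. alg_hom_on sW aW UNIV sM aM f}"

definition fun_scale :: "(complex \<Rightarrow> 'm \<Rightarrow> 'm) \<Rightarrow> complex \<Rightarrow> ('w \<Rightarrow> 'm) \<Rightarrow> 'w \<Rightarrow> 'm" where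
  "fun_scale sM c f = (\<lambda>w. sM c (f w))"

definition fun_modes :: "('v \<Rightarrow> int \<Rightarrow> 'm \<Rightarrow> 'm) \<Rightarrow> 'v \<Rightarrow> int \<Rightarrow> ('w \<Rightarrow> 'm) \<Rightarrow> 'w \<Rightarrow> 'm" where
  "fun_modes YM v n f = (\<lambda>w. YM v n (f w))"

text \<open>\<open>\<chi> \<in> Irr\<^sub>M(A)\<close>, with \<open>W\<close> as a model of \<open>W\<^sub>\<chi>\<close>\<close>

definition in_Irr ::
  "(complex \<Rightarrow> 'a::{ring,monoid_mult} \<Rightarrow> 'a) \<Rightarrow>
   (complex \<Rightarrow> 'm::ab_group_add \<Rightarrow> 'm) \<Rightarrow> ('a \<Rightarrow> 'm \<Rightarrow> 'm) \<Rightarrow> ('a \<Rightarrow> complex) \<Rightarrow>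
   (complex \<Rightarrow> 'w::ab_group_add \<Rightarrow> 'w) \<Rightarrow> ('a \<Rightarrow> 'w \<Rightarrow> 'w) \<Rightarrow> bool" where
  "in_Irr sA sM aM \<chi> sW aW \<longleftrightarrow>
     simple_module_with_character sA \<chi> sW aW \<and> mult_space sW aW sM aM \<noteq> {0}"

end

theory Submission
  imports Defs
begin

text \<open>A nonzero \<open>f \<in> M\<^sub>\<lambda>\<close> is injective, so \<open>g \<circ> f\<^sup>-\<^sup>1 : f(W\<^sub>\<lambda>) \<rightarrow> M\<close> makes sense for every
  \<open>g \<in> M\<^sub>\<lambda>\<close> and is realised by modes; these carry \<open>f\<close> to \<open>g\<close>, whence irreducibility. If \<open>f\<close>
  corresponds to \<open>g \<in> M\<^sub>\<mu>\<close> under an isomorphism and \<open>f(W\<^sub>\<lambda>) \<inter> g(W\<^sub>\<mu>) = 0\<close>, modes realising the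
  projection of \<open>f(W\<^sub>\<lambda>) + g(W\<^sub>\<mu>)\<close> onto the first summand fix \<open>f\<close> and annihilate \<open>g\<close>, a
  contradiction; so the two images coincide and \<open>W\<^sub>\<lambda> \<cong> W\<^sub>\<mu>\<close>. The converse is the fact that a
  simple module over a semisimple algebra is determined by its character.\<close>

section \<open>Independence of the trace from the basis\<close>

context vector_space
begin

text \<open>This is the identity tr(PQ) = tr(QP). Expanding \<open>f b\<close> in \<open>C\<close>
  and each \<open>c\<close> in \<open>B\<close> turns the first trace into a double sum. Summed over
  \<open>b\<close> first, it contains the image under \<open>f\<close> of the
  \<open>B\<close>-expansion of \<open>c\<close>, which gives the second trace.\<close>

lemma sum_representation_basis_change:
  assumes B: "finite B" "independent B" "span B = UNIV"
    and C: "finite C" "independent C" "span C = UNIV"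
    and f: "Vector_Spaces.linear scale scale f"
  shows "(\<Sum>b\<in>B. representation B (f b) b) = (\<Sum>c\<in>C. representation C (f c) c)"
proof -
  interpret f: Vector_Spaces.linear scale scale f by (rule f)
  have expB: "x = (\<Sum>b\<in>B. representation B x b *s b)" for x
    using B by (simp add: sum_representation_eq)
  have expC: "x = (\<Sum>c\<in>C. representation C x c *s c)" for x
    using C by (simp add: sum_representation_eq)
  have rB: "representation B (\<Sum>c\<in>C. k c *s g c) b = (\<Sum>c\<in>C. k c * representation B (g c) b)"
    for k g b
    using B by (simp add: representation_sum representation_scale)
  have rC: "representation C (\<Sum>b\<in>B. k b *s g b) c = (\<Sum>b\<in>B. k b * representation C (g b) c)"
    for k g c
    using C by (simp add: representation_sum representation_scale)
  have "(\<Sum>b\<in>B. representation B (f b) b)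
      = (\<Sum>b\<in>B. \<Sum>c\<in>C. representation C (f b) c * representation B c b)"
  proof (intro sum.cong refl)
    fix b
    show "representation B (f b) b = (\<Sum>c\<in>C. representation C (f b) c * representation B c b)"
      using rB[of "representation C (f b)" "\<lambda>c. c" b] unfolding expC[of "f b", symmetric] .
  qed
  also have "\<dots> = (\<Sum>c\<in>C. \<Sum>b\<in>B. representation B c b * representation C (f b) c)"
    by (subst sum.swap) (simp add: mult.commute)
  also have "\<dots> = (\<Sum>c\<in>C. representation C (f c) c)"
  proof (intro sum.cong refl)
    fix c
    have "f c = (\<Sum>b\<in>B. representation B c b *s f b)"
      using arg_cong[OF expB[of c], of f] by (simp add: f.sum f.scale)
    then show "(\<Sum>b\<in>B. representation B c b * representation C (f b) c) = representation C (f c) c"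
      by (simp add: rC)
  qed
  finally show ?thesis .
qed

lemma extend_basis_empty:
  shows "independent (extend_basis {})" "span (extend_basis {}) = UNIV"
  by (simp_all add: independent_extend_basis independent_empty span_extend_basis)

lemma finite_extend_basis_empty:
  assumes "finite_dim UNIV"
  shows "finite (extend_basis {})"
proof -
  obtain B where "finite B" "span B = UNIV"
    using assms unfolding finite_dim_def by auto
  then show ?thesis
    using independent_span_bound[of B "extend_basis {}"] extend_basis_empty by auto
qed

lemma endo_trace_eq:
  assumes "finite B" "independent B" "span B = UNIV" "Vector_Spaces.linear scale scale f"
  shows "endo_trace f = (\<Sum>b\<in>B. representation B (f b) b)"
proof -
  have "finite_dim UNIV"
    using assms unfolding finite_dim_def by auto
  then show ?thesis
    unfolding endo_trace_def Let_def
    by (intro sum_representation_basis_change assms extend_basis_empty finite_extend_basis_empty)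
qed

lemma endo_trace_zero: "endo_trace (\<lambda>x. 0) = 0"
  by (simp add: endo_trace_def representation_zero)

lemma endo_trace_id:
  assumes "finite B" "independent B" "span B = UNIV"
  shows "endo_trace (\<lambda>x. x) = of_nat (card B)"
  by (simp add: endo_trace_eq[OF assms linear_ident] representation_basis assms(2))

end

text \<open>The image of a basis \<open>B\<close> under \<open>\<phi>\<close> is a basis, and the
  coordinates of \<open>\<phi> x\<close> in it are those of \<open>x\<close> in \<open>B\<close>. So
  \<open>f\<close> and \<open>g\<close> have the same matrix in these two bases.\<close>

lemma endo_trace_transport:
  fixes s1 :: "'k::field \<Rightarrow> 'x::ab_group_add \<Rightarrow> 'x"
    and s2 :: "'k \<Rightarrow> 'y::ab_group_add \<Rightarrow> 'y"
  assumes \<phi>: "Vector_Spaces.linear s1 s2 \<phi>" "bij \<phi>"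
    and fd: "vector_space.finite_dim s1 UNIV"
    and f: "Vector_Spaces.linear s1 s1 f" and g: "Vector_Spaces.linear s2 s2 g"
    and comm: "\<And>x. \<phi> (f x) = g (\<phi> x)"
  shows "vector_space.endo_trace s1 f = vector_space.endo_trace s2 g"
proof -
  interpret \<phi>: Vector_Spaces.linear s1 s2 \<phi> by (rule \<phi>(1))
  define B where "B = \<phi>.vs1.extend_basis {}"
  have B: "finite B" "\<phi>.vs1.independent B" "\<phi>.vs1.span B = UNIV"
    unfolding B_def by (simp_all add: \<phi>.vs1.extend_basis_empty \<phi>.vs1.finite_extend_basis_empty fd)
  have inj: "inj \<phi>" and surj: "surj \<phi>"
    using \<phi>(2) by (auto simp: bij_def)
  have C: "finite (\<phi> ` B)" "\<phi>.vs2.independent (\<phi> ` B)" "\<phi>.vs2.span (\<phi> ` B) = UNIV"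
    using B \<phi>.independent_injective_image[OF B(2)] inj surj
    by (auto simp: \<phi>.span_image inj_on_subset[OF inj subset_UNIV])
  have rep: "\<phi>.vs2.representation (\<phi> ` B) (\<phi> x) (\<phi> b) = \<phi>.vs1.representation B x b" if "b \<in> B" for x b
  proof -
    have "x = (\<Sum>c\<in>B. s1 (\<phi>.vs1.representation B x c) c)"
      using B by (simp add: \<phi>.vs1.sum_representation_eq)
    then have "\<phi> x = (\<Sum>c\<in>B. s2 (\<phi>.vs1.representation B x c) (\<phi> c))"
      by (metis (no_types, lifting) \<phi>.sum \<phi>.scale sum.cong)
    then have "\<phi>.vs2.representation (\<phi> ` B) (\<phi> x) (\<phi> b)
       = (\<Sum>c\<in>B. \<phi>.vs1.representation B x c * \<phi>.vs2.representation (\<phi> ` B) (\<phi> c) (\<phi> b))"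
      using C by (simp add: \<phi>.vs2.representation_sum \<phi>.vs2.representation_scale)
    also have "\<dots> = (\<Sum>c\<in>B. if c = b then \<phi>.vs1.representation B x b else 0)"
      using C inj by (intro sum.cong refl) (auto simp: \<phi>.vs2.representation_basis inj_eq)
    finally show ?thesis
      using B(1) that by simp
  qed
  have "\<phi>.vs2.endo_trace g = (\<Sum>c\<in>\<phi> ` B. \<phi>.vs2.representation (\<phi> ` B) (g c) c)"
    by (rule \<phi>.vs2.endo_trace_eq[OF C g])
  also have "\<dots> = (\<Sum>b\<in>B. \<phi>.vs2.representation (\<phi> ` B) (\<phi> (f b)) (\<phi> b))"
    using inj by (simp add: sum.reindex inj_on_subset[OF inj subset_UNIV] comm)
  also have "\<dots> = (\<Sum>b\<in>B. \<phi>.vs1.representation B (f b) b)"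
    by (simp add: rep)
  also have "\<dots> = \<phi>.vs1.endo_trace f"
    by (rule \<phi>.vs1.endo_trace_eq[OF B f, symmetric])
  finally show ?thesis ..
qed

section \<open>Homomorphisms and simple modules\<close>

lemma alg_hom_onD:
  assumes "alg_hom_on sX aX X sM aM f"
  shows "x \<in> X \<Longrightarrow> y \<in> X \<Longrightarrow> f (x + y) = f x + f y"
    and "x \<in> X \<Longrightarrow> f (sX c x) = sM c (f x)"
    and "x \<in> X \<Longrightarrow> f (aX a x) = aM a (f x)"
  using assms by (auto simp: alg_hom_on_def)

lemma alg_submoduleD:
  assumes "alg_submodule sM aM X"
  shows "module.subspace sM X" and "x \<in> X \<Longrightarrow> aM a x \<in> X"
  using assms by (auto simp: alg_submodule_def)

lemma simple_submoduleD:
  assumes "simple_submodule sM aM X"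
  shows "alg_submodule sM aM X" and "X \<noteq> {0}"
    and "alg_submodule sM aM U \<Longrightarrow> U \<subseteq> X \<Longrightarrow> U = {0} \<or> U = X"
  using assms by (auto simp: simple_submodule_def)

context alg_module
begin

lemma act_zero_right: "aM x 0 = 0"
  using act_scale_right[of x 0 0] by simp

lemma act_zero_left: "aM 0 w = 0"
  using act_scale_left[of 0 0 w] by simp

lemma act_linear: "Vector_Spaces.linear sM sM (aM a)"
  by unfold_locales (simp_all add: act_add_right act_scale_right)

lemma regular_module: "alg_module sA sA (*)"
  by unfold_locales (simp_all add: scale_mult_left scale_mult_right algebra_simps)

lemma orbit_linear: "Vector_Spaces.linear sA sM (\<lambda>a. aM a w)"
  by unfold_locales (simp_all add: act_add_left act_scale_left)

lemma orbit_alg_hom: "alg_hom_on sA (*) L sM aM (\<lambda>a. aM a w)"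
  by (simp add: alg_hom_on_def act_add_left act_scale_left act_mult)

end

section \<open>Kernels, images and Schur's lemma\<close>

locale alg_module_pair = N: alg_module sA sN aN + M: alg_module sA sM aM
  for sA :: "complex \<Rightarrow> 'a::{ring,monoid_mult} \<Rightarrow> 'a"
    and sN :: "complex \<Rightarrow> 'n::ab_group_add \<Rightarrow> 'n" and aN
    and sM :: "complex \<Rightarrow> 'm::ab_group_add \<Rightarrow> 'm" and aM
begin

lemma alg_hom_UNIV_linear:
  assumes "alg_hom_on sN aN UNIV sM aM f"
  shows "Vector_Spaces.linear sN sM f"
  by unfold_locales (simp_all add: alg_hom_onD[OF assms])

context
  fixes X f
  assumes X: "alg_submodule sN aN X" and f: "alg_hom_on sN aN X sM aM f"
begin

lemma alg_hom_zero: "f 0 = 0"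
proof -
  have "0 \<in> X"
    using alg_submoduleD(1)[OF X] by (rule N.M.subspace_0)
  from alg_hom_onD(2)[OF f this, of 0] show ?thesis by simp
qed

lemma alg_hom_diff:
  assumes "x \<in> X" "y \<in> X"
  shows "f (x - y) = f x - f y"
proof -
  have "x - y \<in> X"
    using alg_submoduleD(1)[OF X] assms by (rule N.M.subspace_diff)
  from alg_hom_onD(1)[OF f this assms(2)] show ?thesis by simp
qed

lemma alg_submodule_image: "alg_submodule sM aM (f ` X)"
  unfolding alg_submodule_def
proof (intro conjI allI ballI M.M.subspaceI)
  note sub = alg_submoduleD(1)[OF X]
  show "0 \<in> f ` X"
    using alg_hom_zero N.M.subspace_0[OF sub] by (metis imageI)
  show "x + y \<in> f ` X" if "x \<in> f ` X" "y \<in> f ` X" for x y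
    using that by (auto simp flip: alg_hom_onD(1)[OF f] intro!: imageI N.M.subspace_add[OF sub])
  show "sM c x \<in> f ` X" if "x \<in> f ` X" for c x
    using that by (auto simp flip: alg_hom_onD(2)[OF f] intro!: imageI N.M.subspace_scale[OF sub])
  show "aM a x \<in> f ` X" if "x \<in> f ` X" for a x
    using that by (auto simp flip: alg_hom_onD(3)[OF f] intro!: imageI alg_submoduleD(2)[OF X])
qed

text \<open>The case \<open>U = {0}\<close> is the kernel, needed for Schur's lemma. Taking for
  \<open>U\<close> the range of another homomorphism later serves to compare two simple images in
  \<open>M\<close>.\<close>

lemma alg_submodule_preimage:
  assumes U: "alg_submodule sM aM U"
  shows "alg_submodule sN aN {x \<in> X. f x \<in> U}"
  unfolding alg_submodule_def
proof (intro conjI allI ballI N.M.subspaceI)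
  note sub = alg_submoduleD(1)[OF X] alg_submoduleD(1)[OF U]
  show "0 \<in> {x \<in> X. f x \<in> U}"
    using alg_hom_zero N.M.subspace_0[OF sub(1)] M.M.subspace_0[OF sub(2)] by simp
  show "x + y \<in> {x \<in> X. f x \<in> U}" if "x \<in> {x \<in> X. f x \<in> U}" "y \<in> {x \<in> X. f x \<in> U}" for x y
    using that N.M.subspace_add[OF sub(1)] M.M.subspace_add[OF sub(2)] alg_hom_onD(1)[OF f] by simp
  show "sN c x \<in> {x \<in> X. f x \<in> U}" if "x \<in> {x \<in> X. f x \<in> U}" for c x
    using that N.M.subspace_scale[OF sub(1)] M.M.subspace_scale[OF sub(2)] alg_hom_onD(2)[OF f]
    by simp
  show "aN a x \<in> {x \<in> X. f x \<in> U}" if "x \<in> {x \<in> X. f x \<in> U}" for a x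
    using that alg_submoduleD(2)[OF X] alg_submoduleD(2)[OF U] alg_hom_onD(3)[OF f] by simp
qed

lemma alg_hom_inv_into:
  assumes inj: "inj_on f X"
  shows "alg_hom_on sM aM (f ` X) sN aN (inv_into X f)"
proof -
  note sub = alg_submoduleD(1)[OF X]
  have inv: "inv_into X f (f x) = x" if "x \<in> X" for x
    using inj that by simp
  have "inv_into X f (f x + f y) = x + y" if "x \<in> X" "y \<in> X" for x y
    using inv[OF N.M.subspace_add[OF sub that]] that by (simp add: alg_hom_onD[OF f])
  moreover have "inv_into X f (sM c (f x)) = sN c x" if "x \<in> X" for c x
    using inv[OF N.M.subspace_scale[OF sub that]] that by (simp add: alg_hom_onD[OF f])
  moreover have "inv_into X f (aM a (f x)) = aN a x" if "x \<in> X" for a x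
    using inv[OF alg_submoduleD(2)[OF X that]] that by (simp add: alg_hom_onD[OF f])
  ultimately show ?thesis
    by (auto simp: alg_hom_on_def inv)
qed

text \<open>First half of Schur's lemma: the kernel is a submodule of the simple module
  \<open>X\<close> that misses \<open>x\<close>, hence it is zero.\<close>

lemma simple_alg_hom_inj_on:
  assumes simple: "simple_submodule sN aN X" and x: "x \<in> X" "f x \<noteq> 0"
  shows "inj_on f X"
proof -
  have "alg_submodule sM aM {0}"
    by (simp add: alg_submodule_def M.act_zero_right M.M.subspace_single_0)
  then have "{x \<in> X. f x \<in> {0}} = {0}"
    using simple_submoduleD(3)[OF simple alg_submodule_preimage[of "{0}"]] x by auto
  then have ker: "\<And>x. x \<in> X \<Longrightarrow> f x = 0 \<Longrightarrow> x = 0"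
    by auto
  show ?thesis
  proof (rule inj_onI)
    fix x y assume "x \<in> X" "y \<in> X" "f x = f y"
    then show "x = y"
      using ker[of "x - y"] alg_hom_diff[of x y] N.M.subspace_diff[OF alg_submoduleD(1)[OF X]] by simp
  qed
qed

text \<open>Second half of Schur's lemma: the image is a submodule of the simple module
  \<open>U\<close> containing \<open>f x \<noteq> 0\<close>.\<close>

lemma alg_hom_onto_simple:
  assumes simple: "simple_submodule sM aM U" and "f ` X \<subseteq> U" and x: "x \<in> X" "f x \<noteq> 0"
  shows "f ` X = U"
  using simple_submoduleD(3)[OF simple alg_submodule_image] assms(2) x by auto

end

end

lemma alg_hom_on_comp:
  assumes "alg_hom_on s1 a1 X s2 a2 f" "alg_hom_on s2 a2 U s3 a3 g" "f ` X \<subseteq> U"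
  shows "alg_hom_on s1 a1 X s3 a3 (g \<circ> f)"
  using assms unfolding alg_hom_on_def by (simp add: image_subset_iff)

section \<open>Simple modules as images of the regular module and of minimal left ideals\<close>

locale simple_alg_module = alg_module sA sM aM
  for sA :: "complex \<Rightarrow> 'a::{ring,monoid_mult} \<Rightarrow> 'a"
    and sM :: "complex \<Rightarrow> 'm::ab_group_add \<Rightarrow> 'm" and aM +
  assumes simple: "simple_submodule sM aM UNIV"
begin

lemma regular_pair: "alg_module_pair sA sA (*) sM aM"
  by (simp add: alg_module_pair_def regular_module alg_module_axioms)

lemma nonzero_vector: obtains w :: 'm where "w \<noteq> 0"
  using simple_submoduleD(2)[OF simple] by blast

lemma regular_submodule: "alg_submodule sA (*) UNIV"
  by (simp add: alg_submodule_def)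

lemma cyclic:
  assumes "w \<noteq> 0"
  shows "range (\<lambda>a. aM a w) = UNIV"
proof (rule alg_module_pair.alg_hom_onto_simple[OF regular_pair regular_submodule orbit_alg_hom simple])
  show "aM 1 w \<noteq> 0"
    using assms by (simp add: act_one)
qed auto

text \<open>The orbit map of a nonzero vector is a linear surjection from the algebra, so it carries
  a finite spanning set to a finite spanning set.\<close>

lemma finite_dim_simple:
  assumes "finite_dim UNIV"
  shows "M.finite_dim UNIV"
proof -
  obtain w :: 'm where w: "w \<noteq> 0" by (rule nonzero_vector)
  interpret l: Vector_Spaces.linear sA sM "\<lambda>a. aM a w" by (rule orbit_linear)
  obtain B where B: "finite B" "span B = UNIV"
    using assms unfolding finite_dim_def by auto
  have "M.span ((\<lambda>a. aM a w) ` B) = UNIV"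
    using l.span_image[of B] B(2) cyclic[OF w] by simp
  then show ?thesis
    using B(1) unfolding M.finite_dim_def by blast
qed

text \<open>On \<open>L\<close> the orbit map of \<open>w\<close> is a nonzero homomorphism between
  simple modules, so both halves of Schur's lemma apply. Thus a minimal left ideal that does not
  annihilate a simple module is isomorphic to it.\<close>

lemma minimal_left_ideal_onto:
  assumes L: "simple_submodule sA (*) L" and a: "a \<in> L" "aM a w \<noteq> 0"
  shows "bij_betw (\<lambda>a. aM a w) L UNIV"
proof -
  note hom = simple_submoduleD(1)[OF L] orbit_alg_hom
  show ?thesis
    unfolding bij_betw_def
    using alg_module_pair.simple_alg_hom_inj_on[OF regular_pair hom L a]
      alg_module_pair.alg_hom_onto_simple[OF regular_pair hom simple subset_UNIV a]
    by blast
qed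

end

section \<open>Characters of simple modules\<close>

locale simple_alg_module_pair =
  W: simple_alg_module sA sW aW + W': simple_alg_module sA sW' aW'
  for sA :: "complex \<Rightarrow> 'a::{ring,monoid_mult} \<Rightarrow> 'a"
    and sW :: "complex \<Rightarrow> 'w::ab_group_add \<Rightarrow> 'w" and aW
    and sW' :: "complex \<Rightarrow> 'u::ab_group_add \<Rightarrow> 'u" and aW'
begin

sublocale alg_module_pair sA sW aW sW' aW' ..

lemma character_eq_of_iso:
  assumes fd: "W.finite_dim UNIV"
    and \<phi>: "alg_hom_on sW aW UNIV sW' aW' \<phi>" "bij \<phi>"
  shows "character sW aW = character sW' aW'"
proof
  fix a
  show "character sW aW a = character sW' aW' a"
    unfolding character_def
    by (rule endo_trace_transport[OF alg_hom_UNIV_linear[OF \<phi>(1)] \<phi>(2) W.finite_dim_simple[OF fd]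
          W.act_linear W'.act_linear])
      (simp add: alg_hom_onD[OF \<phi>(1)])
qed

text \<open>\<open>L\<close> annihilates neither module, so it is isomorphic to both. The
  isomorphism goes back from \<open>W\<close> to \<open>L\<close> and then on to
  \<open>W'\<close>.\<close>

lemma iso_of_minimal_left_ideal:
  assumes L: "simple_submodule sA (*) L"
    and a: "a \<in> L" "aW a w \<noteq> 0" and a': "a' \<in> L" "aW' a' w' \<noteq> 0"
  shows "\<exists>\<phi>. alg_hom_on sW aW UNIV sW' aW' \<phi> \<and> bij \<phi>"
proof (intro exI conjI)
  let ?f = "\<lambda>a. aW a w" and ?g = "\<lambda>a. aW' a w'"
  have f: "bij_betw ?f L UNIV" and g: "bij_betw ?g L UNIV"
    by (rule W.minimal_left_ideal_onto[OF L a] W'.minimal_left_ideal_onto[OF L a'])+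
  have inv: "bij_betw (inv_into L ?f) UNIV L"
    by (rule bij_betw_inv_into[OF f])
  have "alg_hom_on sW aW UNIV sA (*) (inv_into L ?f)"
    using alg_module_pair.alg_hom_inv_into[OF W.regular_pair simple_submoduleD(1)[OF L]
        W.orbit_alg_hom[of L w]] f
    by (simp add: bij_betw_def)
  then show "alg_hom_on sW aW UNIV sW' aW' (?g \<circ> inv_into L ?f)"
    using W'.orbit_alg_hom by (rule alg_hom_on_comp[where U = L])
      (use inv in \<open>simp add: bij_betw_def\<close>)
  show "bij (?g \<circ> inv_into L ?f)"
    by (rule bij_betw_trans[OF inv g])
qed

text \<open>Split the unit as \<open>1 = e + b\<close>, where \<open>b\<close> lies in the sum of the minimal left ideals that
  annihilate \<open>W\<close> and \<open>e\<close> in the sum of the others. If the latter annihilate \<open>W'\<close>, then \<open>e\<close> acts as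
  the identity on \<open>W\<close> and as zero on \<open>W'\<close>, so its traces are \<open>dim W \<noteq> 0\<close> and \<open>0\<close>.\<close>

lemma iso_of_character_eq:
  assumes "fd_semisimple_algebra sA"
    and char: "character sW aW = character sW' aW'"
  shows "\<exists>\<phi>. alg_hom_on sW aW UNIV sW' aW' \<phi> \<and> bij \<phi>"
proof (rule ccontr)
  assume niso: "\<not> ?thesis"
  interpret A: fd_semisimple_algebra sA by fact
  let ?Z = "{L. simple_submodule sA (*) L \<and> (\<forall>a\<in>L. \<forall>w. aW a w = 0)}"
  let ?N = "{L. simple_submodule sA (*) L \<and> \<not> (\<forall>a\<in>L. \<forall>w. aW a w = 0)}"
  have ann_subspace: "W.subspace {a. aW a w = 0}" for w
    by (rule W.subspaceI) (simp_all add: W.act_zero_left W.act_add_left W.act_scale_left)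
  have ann_subspace': "W.subspace {a. aW' a w = 0}" for w
    by (rule W.subspaceI) (simp_all add: W'.act_zero_left W'.act_add_left W'.act_scale_left)
  have "{L. simple_submodule sA (*) L} = ?N \<union> ?Z"
    by blast
  then have "W.span (\<Union>?N \<union> \<Union>?Z) = UNIV"
    using A.semisimple by (metis Union_Un_distrib)
  then have "1 \<in> W.span (\<Union>?N \<union> \<Union>?Z)"
    by simp
  then obtain e b where eb: "1 = e + b" "e \<in> W.span (\<Union>?N)" "b \<in> W.span (\<Union>?Z)"
    unfolding W.span_Un by blast
  have b: "aW b w = 0" for w
    using eb(3) W.span_minimal[OF _ ann_subspace[of w], of "\<Union>?Z"] by blast
  have e: "aW e w = w" for w
    using W.act_add_left[of e b w] W.act_one[of w] eb(1) b by simp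
  \<comment> \<open>A member of \<open>?N\<close> acts nontrivially on \<open>W\<close>. If it did
    so on \<open>W'\<close> too, it would be isomorphic to both modules, contrary to
    \<open>niso\<close>.\<close>
  have "\<Union>?N \<subseteq> {a. aW' a w = 0}" for w
    using niso iso_of_minimal_left_ideal by blast
  then have e': "aW' e w = 0" for w
    using eb(2) W.span_minimal[OF _ ann_subspace'[of w], of "\<Union>?N"] by blast
  let ?B = "W.M.extend_basis {}"
  have fin: "finite ?B"
    by (intro W.M.finite_extend_basis_empty W.finite_dim_simple A.finite_dimensional)
  have "W.M.endo_trace (aW e) = of_nat (card ?B)"
    using W.M.endo_trace_id[OF fin W.M.extend_basis_empty] e by (metis ext)
  moreover have "W'.M.endo_trace (aW' e) = 0"
    using W'.M.endo_trace_zero e' by (metis ext)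
  \<comment> \<open>Characteristic zero matters here: \<open>of_nat (card ?B) = 0\<close> over the
    complex numbers forces the dimension itself to vanish.\<close>
  ultimately have "card ?B = 0"
    using fun_cong[OF char, of e] by (simp add: character_def)
  then have "?B = {}"
    using fin by simp
  then have "(UNIV :: 'w set) = {0}"
    using W.M.extend_basis_empty(2) W.M.span_empty by simp
  then show False
    using simple_submoduleD(2)[OF W.simple] by simp
qed

end

section \<open>Multiplicity spaces\<close>

lemma sum_fun_apply: "(\<Sum>x\<in>A. F x) w = (\<Sum>x\<in>A. F x w)"
  by (induction A rule: infinite_finite_induct) auto

locale alg_va_mult_space =
  alg_va_module sA sV vac Y sM aM YM + W: simple_alg_module sA sW aW
  for sA :: "complex \<Rightarrow> 'a::{ring,monoid_mult} \<Rightarrow> 'a"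
    and sV :: "complex \<Rightarrow> 'v::ab_group_add \<Rightarrow> 'v" and vac Y
    and sM :: "complex \<Rightarrow> 'm::ab_group_add \<Rightarrow> 'm" and aM YM
    and sW :: "complex \<Rightarrow> 'w::ab_group_add \<Rightarrow> 'w" and aW
begin

sublocale WM: alg_module_pair sA sW aW sM aM ..

abbreviation Hom where "Hom \<equiv> mult_space sW aW sM aM"

lemma Hom_iff: "f \<in> Hom \<longleftrightarrow> alg_hom_on sW aW UNIV sM aM f"
  by (simp add: mult_space_def)

lemma Hom_zero: "0 \<in> Hom"
  by (simp add: Hom_iff alg_hom_on_def act_zero_right)

lemma Hom_add: "f \<in> Hom \<Longrightarrow> g \<in> Hom \<Longrightarrow> f + g \<in> Hom"
  by (simp add: Hom_iff alg_hom_on_def act_add_right M.scale_right_distrib algebra_simps)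

lemma Hom_scale: "f \<in> Hom \<Longrightarrow> fun_scale sM c f \<in> Hom"
  by (simp add: Hom_iff alg_hom_on_def fun_scale_def act_scale_right M.scale_right_distrib
      M.scale_left_commute)

lemma Hom_modes: "f \<in> Hom \<Longrightarrow> fun_modes YM v n f \<in> Hom"
  by (simp add: Hom_iff alg_hom_on_def fun_modes_def actions_commute va.YM_add_right
      va.YM_scale_right)

lemma Hom_inj:
  assumes "f \<in> Hom" "f w \<noteq> 0"
  shows "inj f"
  using WM.simple_alg_hom_inj_on[OF simple_submoduleD(1)[OF W.simple] _ W.simple UNIV_I] assms
  by (simp add: Hom_iff)

lemma Hom_at_zero: "f \<in> Hom \<Longrightarrow> f 0 = 0"
  using WM.alg_hom_zero[OF simple_submoduleD(1)[OF W.simple]] by (simp add: Hom_iff)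

text \<open>A nonzero homomorphism out of a simple module is injective, so it cannot send both
  \<open>w\<close> and \<open>0\<close> to \<open>0\<close>. Evaluation at a single nonzero vector
  therefore detects whether an element of \<open>Hom\<close> vanishes.\<close>

lemma Hom_eq_zero_iff:
  assumes "f \<in> Hom" "w \<noteq> 0"
  shows "f w = 0 \<longleftrightarrow> f = 0"
proof
  assume "f w = 0"
  then have "\<not> inj f"
    using assms Hom_at_zero by (metis injD)
  then show "f = 0"
    using Hom_inj[OF assms(1)] by (auto simp: fun_eq_iff)
qed simp

text \<open>\<^const>\<open>Sum_any\<close> commutes with evaluation because, by simplicity of \<open>W\<close>, a homomorphism vanishes
  as soon as it vanishes at one nonzero vector, so the supports agree.\<close>

lemma Sum_any_Hom_apply:
  assumes F: "\<And>x. F x \<in> Hom"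
  shows "Sum_any F w = Sum_any (\<lambda>x. F x w)"
proof (cases "w = 0")
  \<comment> \<open>At the zero vector the supports may differ, but every summand vanishes there, so
    both sides are \<open>0\<close>.\<close>
  case True
  then show ?thesis
    using Hom_at_zero[OF F] by (simp add: Sum_any.expand_set sum_fun_apply)
next
  case False
  then show ?thesis
    using Hom_eq_zero_iff[OF F False] by (simp add: Sum_any.expand_set sum_fun_apply)
qed

lemma fdist_mult_Hom_apply:
  assumes F: "\<And>i j k. F i j k \<in> Hom"
  shows "fdist_mult (fun_scale sM) D F a b c w = fdist_mult sM D (\<lambda>i j k. F i j k w) a b c"
  unfolding fdist_mult_def
proof (subst Sum_any_Hom_apply)
  show "(case x of (i, j, k) \<Rightarrow> fun_scale sM (D i j k) (F (a - i) (b - j) (c - k))) \<in> Hom" for x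
    by (simp add: F Hom_scale split: prod.splits)
qed (auto simp: fun_scale_def intro!: arg_cong[where f = Sum_any])

text \<open>Modes act on \<open>f\<close> through its values, and the coefficients of the three
  products may be evaluated pointwise. At \<open>w\<close> the identity becomes the Jacobi identity
  of \<open>M\<close> for the vector \<open>f w\<close>.\<close>

lemma Hom_jacobi:
  assumes f: "f \<in> Hom"
  shows "jacobi_identity Y (fun_scale sM) (fun_modes YM) u v f"
  unfolding jacobi_identity_def
proof (intro allI ext)
  fix a b c w
  have if_apply: "(if P then p else 0) w = (if P then p w else 0)" for P and p :: "'w \<Rightarrow> 'm"
    by simp
  show "(fdist_mult (fun_scale sM) delta_12
       (\<lambda>a b c. if a = 0 then fun_modes YM u (- b - 1) (fun_modes YM v (- c - 1) f) else 0) a b c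
     - fdist_mult (fun_scale sM) delta_21
       (\<lambda>a b c. if a = 0 then fun_modes YM v (- c - 1) (fun_modes YM u (- b - 1) f) else 0) a b c) w
     = fdist_mult (fun_scale sM) delta_10
       (\<lambda>a b c. if b = 0 then fun_modes YM (Y u (- a - 1) v) (- c - 1) f else 0) a b c w"
    using va.YM_jacobi[of "f w" u v]
    by (simp add: fdist_mult_Hom_apply Hom_zero Hom_modes f if_apply jacobi_identity_def)
      (simp add: fun_modes_def cong: if_cong)
qed

lemma fun_vector_space: "vector_space (fun_scale sM :: complex \<Rightarrow> ('w \<Rightarrow> 'm) \<Rightarrow> _)"
  by unfold_locales
    (simp_all add: fun_scale_def fun_eq_iff M.scale_right_distrib M.scale_left_distrib)

lemma Hom_va_module: "va_module sV vac Y (fun_scale sM) Hom (fun_modes YM)"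
proof -
  interpret F: vector_space "fun_scale sM :: complex \<Rightarrow> ('w \<Rightarrow> 'm) \<Rightarrow> _"
    by (rule fun_vector_space)
  show ?thesis
  proof unfold_locales
    show "F.subspace Hom"
      by (intro F.subspaceI Hom_zero Hom_add Hom_scale)
    show "\<exists>N. \<forall>n\<ge>N. fun_modes YM v n f = 0" if f: "f \<in> Hom" for v f
    proof -
      \<comment> \<open>Truncation in \<open>M\<close> gives a bound depending on the vector,
        whereas one bound is needed for all values of \<open>f\<close>. The bound for one nonzero
        \<open>w\<close> suffices, since a mode of \<open>f\<close> that vanishes at
        \<open>w\<close> is zero.\<close>
      obtain w :: 'w where w: "w \<noteq> 0" by (rule W.nonzero_vector)
      obtain N where "\<forall>n\<ge>N. YM v n (f w) = 0"
        using va.YM_truncation by blast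
      then have "\<forall>n\<ge>N. fun_modes YM v n f = 0"
        using Hom_eq_zero_iff[OF Hom_modes[OF f] w] by (metis fun_modes_def)
      then show ?thesis ..
    qed
    show "fun_modes YM v n f \<in> Hom" if "f \<in> Hom" for v n f
      using that by (rule Hom_modes)
  qed (auto simp: Hom_jacobi fun_eq_iff fun_modes_def fun_scale_def va.YM_add_left
      va.YM_scale_left va.YM_add_right va.YM_scale_right va.YM_vac)
qed

text \<open>The range is spanned by the image of a finite spanning set of \<open>W\<close>. This
  makes the assumption on finite dimensional submodules of \<open>M\<close> applicable to
  it.\<close>

lemma Hom_range_finite_dim:
  assumes "finite_dim UNIV" "f \<in> Hom"
  shows "M.finite_dim (range f)"
proof -
  interpret l: Vector_Spaces.linear sW sM f
    using assms(2) by (intro WM.alg_hom_UNIV_linear) (simp add: Hom_iff)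
  obtain B where "finite B" "W.M.span B = UNIV"
    using W.finite_dim_simple[OF assms(1)] unfolding W.M.finite_dim_def by auto
  then show ?thesis
    unfolding M.finite_dim_def by (metis finite_imageI l.span_image)
qed

lemma Hom_range_submodule: "f \<in> Hom \<Longrightarrow> alg_submodule sM aM (range f)"
  using WM.alg_submodule_image[OF simple_submoduleD(1)[OF W.simple]] by (simp add: Hom_iff)

lemma Hom_irreducible:
  assumes fd: "finite_dim UNIV" and nz: "Hom \<noteq> {0}"
    and modes: "\<And>X f. \<lbrakk>alg_submodule sM aM X; M.finite_dim X; alg_hom_on sM aM X sM aM f\<rbrakk>
           \<Longrightarrow> \<exists>(n::nat) (v :: nat \<Rightarrow> 'v) (i :: nat \<Rightarrow> int).
                 \<forall>x\<in>X. f x = (\<Sum>k<n. YM (v k) (i k) x)"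
  shows "irreducible_va_module sV vac Y (fun_scale sM) Hom (fun_modes YM)"
proof -
  interpret F: va_module sV vac Y "fun_scale sM" Hom "fun_modes YM"
    by (rule Hom_va_module)
  show ?thesis
  proof unfold_locales
    show "Hom \<noteq> {0}" by (rule nz)
    fix T assume T: "T \<subseteq> Hom" "F.M.subspace T" and
      closed: "\<And>v n f. f \<in> T \<Longrightarrow> fun_modes YM v n f \<in> T"
    show "T = {0} \<or> T = Hom"
    proof (rule disjCI)
      assume "T \<noteq> Hom"
      have "T \<subseteq> {0}"
      proof (rule ccontr)
        assume "\<not> T \<subseteq> {0}"
        then obtain f where f: "f \<in> T" "f \<noteq> 0" by blast
        then obtain w where "f w \<noteq> 0" by (auto simp: fun_eq_iff)
        then have fH: "f \<in> Hom" and inj: "inj f"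
          using f T Hom_inj by blast+
        have inv: "alg_hom_on sM aM (range f) sW aW (inv f)"
          using WM.alg_hom_inv_into[OF simple_submoduleD(1)[OF W.simple] _ inj] fH
          by (simp add: Hom_iff)
        have "g \<in> T" if g: "g \<in> Hom" for g
        proof -
          \<comment> \<open>This homomorphism sends \<open>f w\<close> to \<open>g w\<close>. The
            modes that realise it on \<open>range f\<close> therefore express \<open>g\<close> as a
            sum of modes applied to \<open>f\<close>, and such a sum stays in
            \<open>T\<close>.\<close>
          have "alg_hom_on sM aM (range f) sM aM (g \<circ> inv f)"
            using inv g by (intro alg_hom_on_comp) (auto simp: Hom_iff)
          then obtain n v i where
            eq: "\<forall>x\<in>range f. (g \<circ> inv f) x = (\<Sum>k<(n::nat). YM (v k) (i k) x)"
            using modes[OF Hom_range_submodule[OF fH] Hom_range_finite_dim[OF fd fH]] by blast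
          have "g = (\<Sum>k<n. fun_modes YM (v k) (i k) f)"
            using eq inj by (simp add: fun_eq_iff sum_fun_apply fun_modes_def)
          also have "\<dots> \<in> T"
            by (intro F.M.subspace_sum[OF T(2)] closed f(1))
          finally show ?thesis .
        qed
        then show False
          using T \<open>T \<noteq> Hom\<close> by blast
      qed
      then show "T = {0}"
        using F.M.subspace_0[OF T(2)] by blast
    qed
  qed
qed

end

section \<open>Comparison of the multiplicity spaces of two simple modules\<close>

locale alg_va_mult_space_pair =
  P: alg_va_mult_space sA sV vac Y sM aM YM sW aW + Q: alg_va_mult_space sA sV vac Y sM aM YM sW' aW'
  for sA :: "complex \<Rightarrow> 'a::{ring,monoid_mult} \<Rightarrow> 'a"
    and sV :: "complex \<Rightarrow> 'v::ab_group_add \<Rightarrow> 'v" and vac Y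
    and sM :: "complex \<Rightarrow> 'm::ab_group_add \<Rightarrow> 'm" and aM YM
    and sW :: "complex \<Rightarrow> 'w::ab_group_add \<Rightarrow> 'w" and aW
    and sW' :: "complex \<Rightarrow> 'u::ab_group_add \<Rightarrow> 'u" and aW'
begin

sublocale simple_alg_module_pair sA sW aW sW' aW' ..

text \<open>Precomposition with \<open>inv \<phi>\<close> has precomposition with
  \<open>\<phi>\<close> as its inverse. It commutes with the modes because these act by
  postcomposition.\<close>

lemma va_isomorphic_of_iso:
  assumes \<phi>: "alg_hom_on sW aW UNIV sW' aW' \<phi>" "bij \<phi>"
  shows "va_isomorphic (fun_scale sM) P.Hom (fun_modes YM) (fun_scale sM) Q.Hom (fun_modes YM)"
proof -
  have inv: "alg_hom_on sW' aW' UNIV sW aW (inv \<phi>)"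
    using alg_hom_inv_into[OF simple_submoduleD(1)[OF P.W.simple] \<phi>(1)] \<phi>(2) by (simp add: bij_def)
  have "f \<circ> inv \<phi> \<in> Q.Hom" if "f \<in> P.Hom" for f
    using that unfolding P.Hom_iff Q.Hom_iff by (rule alg_hom_on_comp[OF inv]) simp
  moreover have "g \<circ> \<phi> \<in> P.Hom" if "g \<in> Q.Hom" for g
    using that unfolding P.Hom_iff Q.Hom_iff by (rule alg_hom_on_comp[OF \<phi>(1)]) simp
  moreover have "\<phi> \<circ> inv \<phi> = id" "inv \<phi> \<circ> \<phi> = id"
    using \<phi>(2) by (simp_all add: bij_is_inj bij_is_surj surj_iff[symmetric])
  ultimately have "bij_betw (\<lambda>f. f \<circ> inv \<phi>) P.Hom Q.Hom"
    by (intro bij_betw_byWitness[where f' = "\<lambda>g. g \<circ> \<phi>"]) (auto simp: comp_assoc)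
  then have "va_module_iso (fun_scale sM) P.Hom (fun_modes YM) (fun_scale sM) Q.Hom (fun_modes YM)
      (\<lambda>f. f \<circ> inv \<phi>)"
    by (simp add: va_module_iso_def fun_eq_iff fun_scale_def fun_modes_def)
  then show ?thesis
    unfolding va_isomorphic_def by blast
qed

lemma ranges_meet_of_va_iso:
  assumes fd: "P.finite_dim UNIV"
    and modes: "\<And>X f. \<lbrakk>alg_submodule sM aM X; P.M.finite_dim X; alg_hom_on sM aM X sM aM f\<rbrakk>
           \<Longrightarrow> \<exists>(n::nat) (v :: nat \<Rightarrow> 'v) (i :: nat \<Rightarrow> int).
                 \<forall>x\<in>X. f x = (\<Sum>k<n. YM (v k) (i k) x)"
    and \<Phi>: "va_module_iso (fun_scale sM) P.Hom (fun_modes YM) (fun_scale sM) Q.Hom (fun_modes YM) \<Phi>"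
    and f: "f \<in> P.Hom" "f \<noteq> 0"
  shows "range f \<inter> range (\<Phi> f) \<noteq> {0}"
proof
  define g where "g = \<Phi> f"
  assume "range f \<inter> range (\<Phi> f) = {0}"
  then have meet: "\<And>w w'. f w = g w' \<Longrightarrow> f w = 0"
    unfolding g_def by (metis Int_iff rangeI singletonD)
  have \<Phi>_add: "\<And>p q. p \<in> P.Hom \<Longrightarrow> q \<in> P.Hom \<Longrightarrow> \<Phi> (p + q) = \<Phi> p + \<Phi> q"
    and \<Phi>_modes: "\<And>v n p. p \<in> P.Hom \<Longrightarrow> \<Phi> (fun_modes YM v n p) = fun_modes YM v n (\<Phi> p)"
    and \<Phi>_bij: "bij_betw \<Phi> P.Hom Q.Hom"
    using \<Phi> by (auto simp: va_module_iso_def)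
  have g: "g \<in> Q.Hom"
    using \<Phi>_bij f(1) by (auto simp: g_def bij_betw_def)
  have \<Phi>_0: "\<Phi> 0 = 0"
    using \<Phi>_add[OF P.Hom_zero P.Hom_zero] by simp
  \<comment> \<open>Additivity of \<open>\<Phi>\<close> is available only on \<open>P.Hom\<close>,
    so membership of the partial sums is carried through the induction.\<close>
  have \<Phi>_sum: "(\<Sum>k\<in>K. p k) \<in> P.Hom \<and> \<Phi> (\<Sum>k\<in>K. p k) = (\<Sum>k\<in>K. \<Phi> (p k))"
    if "\<And>k. p k \<in> P.Hom" for p and K :: "nat set"
  proof (induction K rule: infinite_finite_induct)
    case (insert k K)
    then show ?case
      unfolding sum.insert[OF insert.hyps] by (metis P.Hom_add \<Phi>_add that)
  qed (use P.Hom_zero \<Phi>_0 in \<open>simp_all only: sum.infinite sum.empty simp_thms\<close>)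
  have f_hom: "alg_hom_on sW aW UNIV sM aM f" and g_hom: "alg_hom_on sW' aW' UNIV sM aM g"
    using f g by (simp_all add: P.Hom_iff Q.Hom_iff)
  note fD = alg_hom_onD[OF f_hom] and gD = alg_hom_onD[OF g_hom]
  have f_diff: "f (x - y) = f x - f y" for x y
    by (rule P.WM.alg_hom_diff[OF simple_submoduleD(1)[OF P.W.simple] f_hom]) auto
  have g_diff: "g (x - y) = g x - g y" for x y
    by (rule Q.WM.alg_hom_diff[OF simple_submoduleD(1)[OF Q.W.simple] g_hom]) auto
  \<comment> \<open>The sum is direct because the ranges meet only in \<open>0\<close>, and
    \<open>h\<close> is the projection onto \<open>range f\<close> along \<open>range g\<close>. The
    choice in \<open>h\<close> is unambiguous: the difference of two decompositions of one vector
    lies in both ranges.\<close>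
  define X where "X = {x + y |x y. x \<in> range f \<and> y \<in> range g}"
  define h where "h x = (SOME y. \<exists>w w'. y = f w \<and> x = f w + g w')" for x
  have h: "h (f w + g w') = f w" for w w'
    unfolding h_def
  proof (rule some_equality)
    fix y assume "\<exists>u u'. y = f u \<and> f w + g w' = f u + g u'"
    then obtain u u' where u: "y = f u" "f w + g w' = f u + g u'" by blast
    then have "f (w - u) = g (u' - w')"
      unfolding f_diff g_diff by (metis add.commute add_diff_cancel_left' add_diff_eq diff_add_eq diff_diff_eq2)
    from meet[OF this] show "y = f w"
      by (simp add: f_diff u)
  qed blast
  have Xe: "\<exists>w w'. x = f w + g w'" if "x \<in> X" for x
    using that unfolding X_def by blast
  have "f w + g w' \<in> X" for w w'
    unfolding X_def by blast
  note Xi = this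
  have add: "(f w + g w') + (f u + g u') = f (w + u) + g (w' + u')" for w w' u u'
    by (simp add: fD gD algebra_simps)
  have scale: "sM c (f w + g w') = f (sW c w) + g (sW' c w')" for c w w'
    by (simp add: fD gD P.M.scale_right_distrib)
  have act: "aM a (f w + g w') = f (aW a w) + g (aW' a w')" for a w w'
    by (simp add: fD gD P.act_add_right)
  obtain B C where BC: "finite B" "P.M.span B = range f" "finite C" "P.M.span C = range g"
    using P.Hom_range_finite_dim[OF fd f(1)] Q.Hom_range_finite_dim[OF fd g]
    unfolding P.M.finite_dim_def by auto
  have "P.M.span (B \<union> C) = X"
    by (simp add: P.M.span_Un X_def BC)
  then have "P.M.finite_dim X"
    unfolding P.M.finite_dim_def using BC by blast
  moreover have "alg_submodule sM aM X"
    unfolding alg_submodule_def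
  proof (intro conjI allI ballI P.M.subspaceI)
    show "0 \<in> X"
      using Xi[of 0 0] P.Hom_at_zero[OF f(1)] Q.Hom_at_zero[OF g] by simp
    show "x + y \<in> X" if "x \<in> X" "y \<in> X" for x y
      using Xe[OF that(1)] Xe[OF that(2)] by (auto simp: add Xi)
    show "sM c x \<in> X" if "x \<in> X" for c x
      using Xe[OF that] by (auto simp: scale Xi)
    show "aM a x \<in> X" if "x \<in> X" for a x
      using Xe[OF that] by (auto simp: act Xi)
  qed
  moreover have "alg_hom_on sM aM X sM aM h"
    unfolding alg_hom_on_def
  proof (intro conjI allI ballI)
    show "h (x + y) = h x + h y" if "x \<in> X" "y \<in> X" for x y
      using Xe[OF that(1)] Xe[OF that(2)] by (auto simp: add h) (simp add: fD)
    show "h (sM c x) = sM c (h x)" if "x \<in> X" for c x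
      using Xe[OF that] by (auto simp: scale h) (simp add: fD)
    show "h (aM a x) = aM a (h x)" if "x \<in> X" for a x
      using Xe[OF that] by (auto simp: act h) (simp add: fD)
  qed
  ultimately obtain n v i where eq: "\<forall>x\<in>X. h x = (\<Sum>k<(n::nat). YM (v k) (i k) x)"
    using modes by blast
  \<comment> \<open>The projection fixes \<open>f w\<close>, written as \<open>f w + g 0\<close> to
    fit the rule for \<open>h\<close>. Below, \<open>g w'\<close> is written as
    \<open>f 0 + g w'\<close> and is sent to \<open>0\<close>.\<close>
  have "(\<Sum>k<n. fun_modes YM (v k) (i k) f) = f"
  proof
    fix w
    show "(\<Sum>k<n. fun_modes YM (v k) (i k) f) w = f w"
      using eq h[of w 0] Xi[of w 0] Q.Hom_at_zero[OF g] by (simp add: sum_fun_apply fun_modes_def)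
  qed
  then have "g = \<Phi> (\<Sum>k<n. fun_modes YM (v k) (i k) f)"
    by (simp add: g_def)
  also have "\<dots> = (\<Sum>k<n. fun_modes YM (v k) (i k) g)"
    using \<Phi>_sum[of "\<lambda>k. fun_modes YM (v k) (i k) f"] P.Hom_modes[OF f(1)]
    by (simp add: \<Phi>_modes f(1) g_def)
  also have "\<dots> = 0"
  proof
    fix w'
    show "(\<Sum>k<n. fun_modes YM (v k) (i k) g) w' = 0 w'"
      using eq h[of 0 w'] Xi[of 0 w'] P.Hom_at_zero[OF f(1)] by (simp add: sum_fun_apply fun_modes_def)
  qed
  \<comment> \<open>The same sum of modes fixes \<open>f\<close> and kills \<open>g\<close>, and
    \<open>\<Phi>\<close> commutes with it. Injectivity of \<open>\<Phi>\<close> on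
    \<open>P.Hom\<close> then contradicts \<open>f \<noteq> 0\<close>.\<close>
  finally have "\<Phi> f = \<Phi> 0"
    by (simp add: g_def \<Phi>_0)
  then show False
    using \<Phi>_bij f P.Hom_zero by (auto simp: bij_betw_def dest: inj_onD)
qed

text \<open>The preimage of \<open>range g\<close> under \<open>f\<close> is a submodule of the
  simple module \<open>W\<close> containing a nonzero vector, hence all of \<open>W\<close>. By
  symmetry the two ranges coincide, and \<open>f\<close> followed by the inverse of \<open>g\<close>
  is the isomorphism.\<close>

lemma iso_of_ranges_meet:
  assumes f: "f \<in> P.Hom" and g: "g \<in> Q.Hom" and meet: "range f \<inter> range g \<noteq> {0}"
  shows "\<exists>\<phi>. alg_hom_on sW aW UNIV sW' aW' \<phi> \<and> bij \<phi>"
proof -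
  have f_hom: "alg_hom_on sW aW UNIV sM aM f" and g_hom: "alg_hom_on sW' aW' UNIV sM aM g"
    using f g by (simp_all add: P.Hom_iff Q.Hom_iff)
  have "0 \<in> range f \<inter> range g"
    using P.Hom_at_zero[OF f] Q.Hom_at_zero[OF g] by (metis IntI rangeI)
  then obtain x where "x \<in> range f" "x \<in> range g" "x \<noteq> 0"
    using meet by blast
  then obtain w w' where w: "f w \<noteq> 0" "f w = g w'"
    by blast
  have U: "alg_submodule sW aW UNIV" and U': "alg_submodule sW' aW' UNIV"
    using P.W.simple Q.W.simple by (auto dest: simple_submoduleD)
  have inj: "inj f" "inj g"
    using P.Hom_inj[OF f w(1)] Q.Hom_inj[OF g, of w'] w by simp_all
  have "{x \<in> UNIV. f x \<in> range g} = {0} \<or> {x \<in> UNIV. f x \<in> range g} = UNIV"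
    by (intro simple_submoduleD(3)[OF P.W.simple] P.WM.alg_submodule_preimage[OF U f_hom]
        Q.Hom_range_submodule g) auto
  moreover have "w \<in> {x \<in> UNIV. f x \<in> range g}" "w \<noteq> 0"
    using w P.Hom_at_zero[OF f] by auto
  ultimately have fg: "range f \<subseteq> range g" by blast
  have "{x \<in> UNIV. g x \<in> range f} = {0} \<or> {x \<in> UNIV. g x \<in> range f} = UNIV"
    by (intro simple_submoduleD(3)[OF Q.W.simple] Q.WM.alg_submodule_preimage[OF U' g_hom]
        P.Hom_range_submodule f) auto
  moreover have "w' \<in> {x \<in> UNIV. g x \<in> range f}" "w' \<noteq> 0"
    using w Q.Hom_at_zero[OF g] by (auto, metis rangeI)
  ultimately have gf: "range g \<subseteq> range f" by blast
  have "alg_hom_on sW aW UNIV sW' aW' (inv g \<circ> f)"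
    by (rule alg_hom_on_comp[OF f_hom Q.WM.alg_hom_inv_into[OF U' g_hom inj(2)] fg])
  moreover have "bij_betw f UNIV (range g)" "bij_betw (inv g) (range g) UNIV"
    using inj fg gf by (auto simp: bij_betw_def inj_on_inv_into)
  then have "bij (inv g \<circ> f)"
    by (rule bij_betw_trans)
  ultimately show ?thesis by blast
qed

end

theorem theorem4p7:
  fixes sA :: "complex \<Rightarrow> 'a::{ring,monoid_mult} \<Rightarrow> 'a"
    and sV :: "complex \<Rightarrow> 'v::ab_group_add \<Rightarrow> 'v"
    and vac :: 'v
    and Y :: "'v \<Rightarrow> int \<Rightarrow> 'v \<Rightarrow> 'v"
    and sM :: "complex \<Rightarrow> 'm::ab_group_add \<Rightarrow> 'm"
    and aM :: "'a \<Rightarrow> 'm \<Rightarrow> 'm"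
    and YM :: "'v \<Rightarrow> int \<Rightarrow> 'm \<Rightarrow> 'm"
  assumes "fd_semisimple_algebra sA"
    and "vertex_algebra sV vac Y"
    and "alg_va_module sA sV vac Y sM aM YM"
    and "\<And>X f. \<lbrakk>alg_submodule sM aM X; vector_space.finite_dim sM X; alg_hom_on sM aM X sM aM f\<rbrakk>
           \<Longrightarrow> \<exists>(n::nat) (v :: nat \<Rightarrow> 'v) (i :: nat \<Rightarrow> int).
                 \<forall>x\<in>X. f x = (\<Sum>k<n. YM (v k) (i k) x)"
  shows "(\<forall>\<chi> (sW :: complex \<Rightarrow> 'w::ab_group_add \<Rightarrow> 'w) aW.
            in_Irr sA sM aM \<chi> sW aW \<longrightarrow>
              irreducible_va_module sV vac Y
                (fun_scale sM) (mult_space sW aW sM aM) (fun_modes YM))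
       \<and> (\<forall>\<chi> \<psi> (sW :: complex \<Rightarrow> 'w1::ab_group_add \<Rightarrow> 'w1) aW
             (sW' :: complex \<Rightarrow> 'w2::ab_group_add \<Rightarrow> 'w2) aW'.
            in_Irr sA sM aM \<chi> sW aW \<and> in_Irr sA sM aM \<psi> sW' aW' \<longrightarrow>
              (va_isomorphic
                 (fun_scale sM) (mult_space sW aW sM aM) (fun_modes YM)
                 (fun_scale sM) (mult_space sW' aW' sM aM) (fun_modes YM)
               \<longleftrightarrow> \<chi> = \<psi>))"
proof (intro conjI allI impI)
  note fd = fd_semisimple_algebra.finite_dimensional[OF assms(1)]
  note modes = assms(4)
  fix \<chi> and sW :: "complex \<Rightarrow> 'w \<Rightarrow> 'w" and aW
  assume irr: "in_Irr sA sM aM \<chi> sW aW"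
  then have "alg_va_mult_space sA sV vac Y sM aM YM sW aW"
    using assms(3) by (simp add: in_Irr_def simple_module_with_character_def
        alg_va_mult_space_def simple_alg_module_def simple_alg_module_axioms_def)
  then interpret alg_va_mult_space sA sV vac Y sM aM YM sW aW .
  show "irreducible_va_module sV vac Y (fun_scale sM) (mult_space sW aW sM aM) (fun_modes YM)"
    using irr by (intro Hom_irreducible fd modes) (auto simp: in_Irr_def)
next
  note fd = fd_semisimple_algebra.finite_dimensional[OF assms(1)]
  note modes = assms(4)
  fix \<chi> \<psi> and sW :: "complex \<Rightarrow> 'w1 \<Rightarrow> 'w1" and aW
    and sW' :: "complex \<Rightarrow> 'w2 \<Rightarrow> 'w2" and aW'
  assume irr: "in_Irr sA sM aM \<chi> sW aW \<and> in_Irr sA sM aM \<psi> sW' aW'"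
  then have "alg_va_mult_space_pair sA sV vac Y sM aM YM sW aW sW' aW'"
    using assms(3) by (simp add: in_Irr_def simple_module_with_character_def
        alg_va_mult_space_pair_def alg_va_mult_space_def simple_alg_module_def
        simple_alg_module_axioms_def)
  then interpret alg_va_mult_space_pair sA sV vac Y sM aM YM sW aW sW' aW' .
  have char: "character sW aW = \<chi>" "character sW' aW' = \<psi>"
    and nz: "P.Hom \<noteq> {0}"
    using irr by (auto simp: in_Irr_def simple_module_with_character_def)
  have "\<chi> = \<psi>"
    if "va_isomorphic (fun_scale sM) P.Hom (fun_modes YM) (fun_scale sM) Q.Hom (fun_modes YM)"
  proof -
    obtain \<Phi> where
      \<Phi>: "va_module_iso (fun_scale sM) P.Hom (fun_modes YM) (fun_scale sM) Q.Hom (fun_modes YM) \<Phi>"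
      using \<open>va_isomorphic _ _ _ _ _ _\<close> unfolding va_isomorphic_def by blast
    \<comment> \<open>Any nonzero \<open>f\<close> will do: its range meets that of
      \<open>\<Phi> f\<close> outside \<open>0\<close>, which makes the two simple modules
      isomorphic and their characters equal.\<close>
    obtain f where f: "f \<in> P.Hom" "f \<noteq> 0"
      using nz P.Hom_zero by blast
    have "\<Phi> f \<in> Q.Hom"
      using \<Phi> f(1) by (auto simp: va_module_iso_def bij_betw_def)
    then show ?thesis
      using iso_of_ranges_meet[OF f(1) _ ranges_meet_of_va_iso[OF fd modes \<Phi> f]]
        character_eq_of_iso[OF fd] char by blast
  qed
  moreover have "va_isomorphic (fun_scale sM) P.Hom (fun_modes YM) (fun_scale sM) Q.Hom (fun_modes YM)"
    if eq: "\<chi> = \<psi>"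
  proof -
    obtain \<phi> where "alg_hom_on sW aW UNIV sW' aW' \<phi>" "bij \<phi>"
      using iso_of_character_eq[OF assms(1)] char eq by auto
    then show ?thesis by (rule va_isomorphic_of_iso)
  qed
  ultimately show "va_isomorphic (fun_scale sM) (mult_space sW aW sM aM) (fun_modes YM)
      (fun_scale sM) (mult_space sW' aW' sM aM) (fun_modes YM) \<longleftrightarrow> \<chi> = \<psi>"
    by blast
qed

end
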